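(* Let $m\ge5$. The values of the cochain map $\overline\Phi\colon\mu^1(C_m)\to C^1(C_m)$ on the (duals of the) critical 1-faces of types (k.1)--(k.3) satisfy the following congruences modulo the span of the basis elements $\left[\begin{smallmatrix}a&c\\ b&d\end{smallmatrix}\right]$ with $a<c$ and $b<d$: (i) for each critical face of type (k.1), $\displaystyle\overline\Phi\left(\left[\begin{smallmatrix}a&m-1\\ b&m\end{smallmatrix}\right]\right)\equiv\left[\begin{smallmatrix}a&a\\ b&m\end{smallmatrix}\right]+\sum\left[\begin{smallmatrix}a&x\\ b&b\end{smallmatrix}\right]-\sum\left[\begin{smallmatrix}y&a\\ b&b\end{smallmatrix}\right]$, where the first summation runs over integers $x\in\{1,\ldots,m-1\}$ with $a<x\ne b$, and the second summation runs over integers $y\in\{1,\ldots,m-1\}$ with $b\ne y<a$; (ii) for each critical face of type (k.2), $\displaystyle\overline\Phi\left(\left[\begin{smallmatrix}m&m\\ b&d\end{smallmatrix}\right]\right)\equiv\sum\left[\begin{smallmatrix}x&x\\ b&d\end{smallmatrix}\right]$, where the summation runs over integers $x\in\{1,\ldots,m\}$ with $b\ne x\ne d$; (iii) for each critical face of type (k.3), $\displaystyle\overline\Phi\left(\left[\begin{smallmatrix}a&c\\ m&m\end{smallmatrix}\right]\right)\equiv\sum\left[\begin{smallmatrix}a&c\\ y&y\end{smallmatrix}\right]$, where the summation runs over integers $y\in\{1,\ldots,m\}$ with $a\ne y\ne c$.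
   Context: Coefficients are in a commutative unital ring $R$; $V_m=\{1,\ldots,m\}$. The complex $C_m$ (a simplicial model of the configuration space of two points on the complete graph on $V_m$): vertices are columns $\begin{smallmatrix}a\\ b\end{smallmatrix}$ with $a,b\in V_m$, $a\ne b$; $k$-faces are arrays $\left[\begin{smallmatrix}a_0&\cdots&a_k\\ b_0&\cdots&b_k\end{smallmatrix}\right]$ with weakly increasing rows, $a_j\ne b_j$, consecutive columns distinct, and each row having at most two distinct entries. Faces are oriented by the displayed order of columns. Conditions making a displayed array a face are implicit. $C^*(C_m)$ is the simplicial cochain complex, with basis the duals of faces (denoted by the same symbols as the faces). $W_m$ is the gradient field on $C_m$ with the following pairings (it is the one produced by the paper's algorithm): (a) $\left[\begin{smallmatrix}a&a\\ b&d\end{smallmatrix}\right]\nearrow\left[\begin{smallmatrix}a&a&m\\ b&d&d\end{smallmatrix}\right]$, $a<m>d$; (b) $\left[\begin{smallmatrix}a&a\\ b&m\end{smallmatrix}\right]\nearrow\left[\begin{smallmatrix}a&a&m-1\\ b&m&m\end{smallmatrix}\right]$, $a<m-1$; (c) $\left[\begin{smallmatrix}a&c\\ b&b\end{smallmatrix}\right]\nearrow\left[\begin{smallmatrix}a&c&c\\ b&b&m\end{smallmatrix}\right]$, $b<m>c$; (d) $\left[\begin{smallmatrix}a&m\\ b&b\end{smallmatrix}\right]\nearrow\left[\begin{smallmatrix}a&m&m\\ b&b&m-1\end{smallmatrix}\right]$, $b<m-1$; (e) $\left[\begin{smallmatrix}a&c\\ b&d\end{smallmatrix}\right]\nearrow\left[\begin{smallmatrix}a&c&c\\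 b&b&d\end{smallmatrix}\right]$, $a<c$, $b<d$, $b\ne c$ and either $c<m>d$ or $c=m>d+1$; (f) $\left[\begin{smallmatrix}a&c\\ b&d\end{smallmatrix}\right]\nearrow\left[\begin{smallmatrix}a&a&c\\ b&d&d\end{smallmatrix}\right]$, $a<c$, $b<d$, $a\ne d$ and either $b=c<m>d$ or $c+1<m=d$; (g) $\left[\begin{smallmatrix}a\\ b\end{smallmatrix}\right]\nearrow\left[\begin{smallmatrix}a&m\\ b&m-1\end{smallmatrix}\right]$, either $b<m-1$ or $a<m-1=b$; (h) $\left[\begin{smallmatrix}a\\ m\end{smallmatrix}\right]\nearrow\left[\begin{smallmatrix}a&m-1\\ m&m\end{smallmatrix}\right]$, $a<m-1$; (i) $\left[\begin{smallmatrix}m-1\\ m\end{smallmatrix}\right]\nearrow\left[\begin{smallmatrix}m-1&m-1\\ m-2&m\end{smallmatrix}\right]$. Critical (unpaired) 1-faces are of types (k.1) $\left[\begin{smallmatrix}a&m-1\\ b&m\end{smallmatrix}\right]$ with $a=m-1>b+1$ or $a<m-1\ge b$; (k.2) $\left[\begin{smallmatrix}m&m\\ b&d\end{smallmatrix}\right]$ with $d<m-1$; (k.3) $\left[\begin{smallmatrix}a&c\\ m&m\end{smallmatrix}\right]$ with $c<m-1$. $\mu^p(C_m)$ is the free $R$-module on (duals of) critical $p$-faces. For a codimension-one face $\alpha\subset\beta$, $\iota_{\alpha,\beta}=\pm1$ is the coefficient of $\alpha$ in $\partial\beta$, where $\partial[v_0,\ldots,v_i]=\sum_j(-1)^j[v_0,\ldots,\widehat{v_j},\ldots,v_i]$.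 An upper path from $\beta$ to $\alpha$ is a sequence $\beta=\alpha_0\nearrow\beta_1\searrow\alpha_1\nearrow\cdots\nearrow\beta_k\searrow\alpha_k=\alpha$ ($k\ge0$), with each $\alpha_{j-1}\nearrow\beta_j$ in $W_m$ and each $\beta_j\searrow\alpha_j$ a codimension-one inclusion $\alpha_j\subset\beta_j$ not in $W_m$; its multiplicity is $\prod_{j=1}^k(-\iota_{\alpha_{j-1},\beta_j}\iota_{\alpha_j,\beta_j})$. For a critical $p$-face $\alpha$, $\overline\Phi(\alpha)=\sum_\beta\left(\sum_\lambda\mu(\lambda)\right)\beta$, where $\beta$ runs over all $p$-faces and $\lambda$ over all upper paths from $\beta$ to $\alpha$, $\mu(\lambda)$ being the multiplicity. *)

theory Defs
  imports Complex_Main "HOL-Library.Function_Algebras"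
begin

section \<open>The complex \<open>C\<^sub>m\<close>\<close>

text \<open>
  A face is the list of its columns, in the displayed order; the column with upper entry \<open>a\<close>
  and lower entry \<open>b\<close> is the pair \<open>(a, b)\<close>.
\<close>

type_synonym column = "nat \<times> nat"
type_synonym face = "column list"

definition is_face :: "nat \<Rightarrow> face \<Rightarrow> bool" where
  "is_face m F \<longleftrightarrow>
     F \<noteq> [] \<and>
     (\<forall>(a, b) \<in> set F. a \<in> {1..m} \<and> b \<in> {1..m} \<and> a \<noteq> b) \<and>
     sorted (map fst F) \<and> sorted (map snd F) \<and>
     distinct_adj F \<and>
     card (fst ` set F) \<le> 2 \<and> card (snd ` set F) \<le> 2"

definition faces :: "nat \<Rightarrow> nat \<Rightarrow> face set" where
  "faces m p = {F. is_face m F \<and> length F = p + 1}"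

text \<open>
  A face is determined by its set of columns, so inclusion of simplices is inclusion of these sets.
\<close>

definition is_facet :: "nat \<Rightarrow> face \<Rightarrow> face \<Rightarrow> bool" where
  "is_facet m A B \<longleftrightarrow> is_face m A \<and> is_face m B \<and> set A \<subseteq> set B \<and> length B = length A + 1"

definition delete_nth :: "nat \<Rightarrow> 'a list \<Rightarrow> 'a list" where
  "delete_nth j xs = take j xs @ drop (Suc j) xs"

definition incidence :: "face \<Rightarrow> face \<Rightarrow> int" where
  "incidence A B = (\<Sum>j<length B. if delete_nth j B = A then (-1) ^ j else 0)"


section \<open>Cochains\<close>

text \<open>
  Cochains are represented as coefficient functions on all arrays; those in \<open>C\<^sup>p(C\<^sub>m)\<close> vanish
  outside \<open>faces m p\<close>, and those in \<open>\<mu>\<^sup>p(C\<^sub>m)\<close> vanish outside the critical \<open>p\<close>-faces.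
\<close>

type_synonym 'r cochain = "face \<Rightarrow> 'r"

definition dual :: "face \<Rightarrow> 'r::comm_ring_1 cochain" where
  "dual F = (\<lambda>G. if G = F then 1 else 0)"

definition cochain_scale :: "'r::comm_ring_1 \<Rightarrow> 'r cochain \<Rightarrow> 'r cochain" (infixr "*\<^sub>C" 75) where
  "r *\<^sub>C f = (\<lambda>F. r * f F)"

interpretation cochain: module "cochain_scale :: 'r::comm_ring_1 \<Rightarrow> 'r cochain \<Rightarrow> 'r cochain"
  by standard (auto simp: cochain_scale_def algebra_simps fun_eq_iff)


section \<open>The gradient field \<open>W\<^sub>m\<close>\<close>

inductive pairing :: "nat \<Rightarrow> face \<Rightarrow> face \<Rightarrow> bool" for m :: nat where
  a: "a < m \<Longrightarrow> d < m \<Longrightarrow>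
      pairing m [(a, b), (a, d)] [(a, b), (a, d), (m, d)]"
| b: "a < m - 1 \<Longrightarrow>
      pairing m [(a, b), (a, m)] [(a, b), (a, m), (m - 1, m)]"
| c: "b < m \<Longrightarrow> c < m \<Longrightarrow>
      pairing m [(a, b), (c, b)] [(a, b), (c, b), (c, m)]"
| d: "b < m - 1 \<Longrightarrow>
      pairing m [(a, b), (m, b)] [(a, b), (m, b), (m, m - 1)]"
| e: "a < c \<Longrightarrow> b < d \<Longrightarrow> b \<noteq> c \<Longrightarrow> (c < m \<and> d < m) \<or> (c = m \<and> d + 1 < m) \<Longrightarrow>
      pairing m [(a, b), (c, d)] [(a, b), (c, b), (c, d)]"
| f: "a < c \<Longrightarrow> b < d \<Longrightarrow> a \<noteq> d \<Longrightarrow> (b = c \<and> c < m \<and> d < m) \<or> (c + 1 < m \<and> m = d) \<Longrightarrow>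
      pairing m [(a, b), (c, d)] [(a, b), (a, d), (c, d)]"
| g: "b < m - 1 \<or> (a < m - 1 \<and> b = m - 1) \<Longrightarrow>
      pairing m [(a, b)] [(a, b), (m, m - 1)]"
| h: "a < m - 1 \<Longrightarrow>
      pairing m [(a, m)] [(a, m), (m - 1, m)]"
| i: "pairing m [(m - 1, m)] [(m - 1, m - 2), (m - 1, m)]"

text \<open>The rules of \<^const>\<open>pairing\<close> leave implicit that both arrays are faces of \<open>C\<^sub>m\<close>.\<close>

definition gradient :: "nat \<Rightarrow> face \<Rightarrow> face \<Rightarrow> bool" where
  "gradient m A B \<longleftrightarrow> is_face m A \<and> is_face m B \<and> pairing m A B"

definition critical_faces :: "nat \<Rightarrow> nat \<Rightarrow> face set" where
  "critical_faces m p = {F \<in> faces m p. \<nexists>G. gradient m F G \<or> gradient m G F}"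


section \<open>Upper paths and the map \<open>\<Phi>\<close>\<close>

text \<open>
  The upper path \<open>\<beta> = \<alpha>\<^sub>0 \<nearrow> \<beta>\<^sub>1 \<searrow> \<alpha>\<^sub>1 \<nearrow> \<dots> \<nearrow> \<beta>\<^sub>k \<searrow> \<alpha>\<^sub>k = \<alpha>\<close> is represented by its starting face \<open>\<beta>\<close>
  and the list of steps \<open>[(\<beta>\<^sub>1, \<alpha>\<^sub>1), \<dots>, (\<beta>\<^sub>k, \<alpha>\<^sub>k)]\<close>.
\<close>

fun is_upper_path :: "nat \<Rightarrow> face \<Rightarrow> (face \<times> face) list \<Rightarrow> face \<Rightarrow> bool" where
  "is_upper_path m \<beta> [] \<alpha> \<longleftrightarrow> \<beta> = \<alpha>"
| "is_upper_path m \<beta> ((B, A) # steps) \<alpha> \<longleftrightarrow>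
     gradient m \<beta> B \<and> is_facet m A B \<and> \<not> gradient m A B \<and> is_upper_path m A steps \<alpha>"

definition upper_paths :: "nat \<Rightarrow> face \<Rightarrow> face \<Rightarrow> (face \<times> face) list set" where
  "upper_paths m \<beta> \<alpha> = {steps. is_upper_path m \<beta> steps \<alpha>}"

fun multiplicity :: "face \<Rightarrow> (face \<times> face) list \<Rightarrow> int" where
  "multiplicity \<beta> [] = 1"
| "multiplicity \<beta> ((B, A) # steps) = - (incidence \<beta> B * incidence A B) * multiplicity A steps"

text \<open>
  \<open>W\<^sub>m\<close> is acyclic, so \<^term>\<open>upper_paths m \<beta> \<alpha>\<close> is finite and the inner sum is meaningful.
\<close>

definition Phi_basis :: "nat \<Rightarrow> nat \<Rightarrow> face \<Rightarrow> 'r::comm_ring_1 cochain" where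
  "Phi_basis m p \<alpha> =
     (\<Sum>\<beta>\<in>faces m p. of_int (\<Sum>l\<in>upper_paths m \<beta> \<alpha>. multiplicity \<beta> l) *\<^sub>C dual \<beta>)"

text \<open>The \<open>R\<close>-linear extension to \<open>\<mu>\<^sup>p(C\<^sub>m)\<close>.\<close>

definition Phi :: "nat \<Rightarrow> nat \<Rightarrow> 'r::comm_ring_1 cochain \<Rightarrow> 'r cochain" where
  "Phi m p f = (\<Sum>\<alpha>\<in>critical_faces m p. f \<alpha> *\<^sub>C Phi_basis m p \<alpha>)"


section \<open>The congruence\<close>

definition diagonal_span :: "nat \<Rightarrow> 'r::comm_ring_1 cochain set" where
  "diagonal_span m =
     cochain.span {dual [(a, b), (c, d)] | a b c d. [(a, b), (c, d)] \<in> faces m 1 \<and> a < c \<and> b < d}"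

definition diagonal_cong :: "nat \<Rightarrow> 'r::comm_ring_1 cochain \<Rightarrow> 'r cochain \<Rightarrow> bool" where
  "diagonal_cong m f g \<longleftrightarrow> f - g \<in> diagonal_span m"

end

theory Submission
  imports Defs
begin

text \<open>
  Fix a critical edge \<open>\<alpha>\<close> and write \<open>w F\<close> for the sum of the multiplicities of the upper paths from the
  edge \<open>F\<close> to \<open>\<alpha>\<close>, which is the coefficient of \<open>F\<close> in \<open>\<Phi>(\<alpha>)\<close>. Splitting off the first step of a path
  gives a recursion: if \<open>F\<close> is the lower face of no pairing, only the empty path can reach \<open>\<alpha>\<close> and
  \<open>w F = [F = \<alpha>]\<close>; if \<open>F \<nearrow> B\<close>, then \<open>w F\<close> is a signed sum of the weights of the two other sides of the
  triangle \<open>B\<close>. Every pairing of edges inserts the third column of \<open>B = [x, y, z]\<close> either at the end, and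
  then \<open>w [x, y] = w [x, z] - w [y, z]\<close>, or in the middle, and then \<open>w [x, z] = w [x, y] + w [y, z]\<close>.

  From an edge with a constant row this recursion ends after very few steps, because the inserted
  columns involve the largest indices \<open>m\<close> and \<open>m - 1\<close>, near which many edges are not paired upwards.
  The edges from \<open>(a, b)\<close> to \<open>(m, b)\<close> have weight 0, as their paths die at edges ending in \<open>(m, m - 1)\<close>.
  This determines the diagonal edges from \<open>(a, b)\<close> to \<open>(m, d)\<close> with \<open>d < m\<close>, and through them the edges
  with constant upper row and lower entries below \<open>m\<close>. The edges from \<open>(a, b)\<close> to \<open>(a, m)\<close> lead to edges
  ending in \<open>(m - 1, m)\<close>, where paths stop. The latter and the edges with constant lower row \<open>m\<close>
  determine the diagonal edges from \<open>(a, b)\<close> to \<open>(c, m)\<close>, and from these the remaining edges with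
  constant lower row are obtained. The other diagonal edges occur on none of these paths, and the
  congruence ignores their weights.

  All the resulting weights are signed sums of indicators that compare \<open>\<alpha>\<close> with an edge determined by \<open>F\<close>
  (\<open>weight_vertical\<close>, \<open>weight_vertical_top\<close>, \<open>weight_horizontal\<close>, \<open>weight_horizontal_last\<close>,
  \<open>weight_horizontal_top\<close>). For \<open>\<alpha>\<close> of each critical type, reading them as functions of \<open>F\<close> gives the three
  sums. The positive and the negative sum for the first type come from the difference that defines the
  weight of an edge with constant lower row: \<open>(a, b)\<close> can be its first or its last column.
\<close>

section \<open>Faces of dimension one and two\<close>

lemma is_face_pair:
  "is_face m [(a, b), (c, d)] \<longleftrightarrow>
     {a, b, c, d} \<subseteq> {1..m} \<and> a \<noteq> b \<and> c \<noteq> d \<and> a \<le> c \<and> b \<le> d \<and> (a, b) \<noteq> (c, d)"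
  by (auto simp: is_face_def card_insert_if)

lemma is_face_triple:
  "is_face m [(a, b), (c, d), (e, f)] \<longleftrightarrow>
     {a, b, c, d, e, f} \<subseteq> {1..m} \<and> a \<noteq> b \<and> c \<noteq> d \<and> e \<noteq> f \<and>
     a \<le> c \<and> c \<le> e \<and> b \<le> d \<and> d \<le> f \<and> (a, b) \<noteq> (c, d) \<and> (c, d) \<noteq> (e, f) \<and>
     (a = c \<or> c = e) \<and> (b = d \<or> d = f)"
  by (auto simp: is_face_def card_insert_if)

lemma columns_of_triple_increasing:
  assumes "is_face m [x, y, z]"
  shows "fst x \<le> fst y" "fst y \<le> fst z" "snd x \<le> snd y" "snd y \<le> snd z" "x \<noteq> y" "y \<noteq> z"
  using assms by (auto simp: is_face_def)

lemma columns_of_triple_distinct: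
  assumes "is_face m [x, y, z]"
  shows "x \<noteq> y" "x \<noteq> z" "y \<noteq> z"
proof -
  note incr = columns_of_triple_increasing[OF assms]
  show "x \<noteq> y" "y \<noteq> z" by (fact incr)+
  show "x \<noteq> z"
  proof
    assume "x = z"
    with incr(1-4) have "x = y" by (simp add: prod_eq_iff)
    with incr(5) show False by contradiction
  qed
qed

lemma is_face_subset:
  assumes "is_face m F" "A \<noteq> []" "set A \<subseteq> set F" "sorted (map fst A)" "sorted (map snd A)"
    "distinct_adj A"
  shows "is_face m A"
proof -
  have "card (fst ` set A) \<le> card (fst ` set F)" "card (snd ` set A) \<le> card (snd ` set F)"
    using assms(3) by (intro card_mono image_mono; simp)+
  moreover have "card (fst ` set F) \<le> 2" "card (snd ` set F) \<le> 2"
    using assms(1) by (simp_all only: is_face_def)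
  moreover have "\<forall>(a, b) \<in> set A. a \<in> {1..m} \<and> b \<in> {1..m} \<and> a \<noteq> b"
    using assms(1,3) unfolding is_face_def by blast
  ultimately show ?thesis
    using assms(2,4-6) unfolding is_face_def by linarith
qed

text \<open>
  An order argument: the columns of a face increase strictly in the product order, so two of the
  three columns can be listed in a single way.
\<close>

lemma facets_of_triple:
  assumes "is_face m [x, y, z]"
  shows "{A. is_facet m A [x, y, z]} = {[x, y], [x, z], [y, z]}"
proof (intro equalityI subsetI)
  note incr = columns_of_triple_increasing[OF assms]
  fix A assume "A \<in> {A. is_facet m A [x, y, z]}"
  then have A: "is_face m A" "set A \<subseteq> {x, y, z}" "length A = 2"
    by (auto simp: is_facet_def)
  then obtain u v where uv: "A = [u, v]"
    by (auto simp: numeral_2_eq_2 length_Suc_conv)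
  then have "fst u \<le> fst v" "snd u \<le> snd v" "u \<noteq> v" and "u \<in> {x, y, z}" "v \<in> {x, y, z}"
    using A by (auto simp: is_face_def)
  with incr show "A \<in> {[x, y], [x, z], [y, z]}"
    unfolding uv by (elim insertE emptyE) (simp_all add: prod_eq_iff)
next
  note incr = columns_of_triple_increasing[OF assms] columns_of_triple_distinct[OF assms]
  fix A assume "A \<in> {[x, y], [x, z], [y, z]}"
  then show "A \<in> {A. is_facet m A [x, y, z]}"
    using incr assms is_face_subset[OF assms, of A] by (auto simp: is_facet_def)
qed

lemma incidence_triple:
  assumes "x \<noteq> y" "x \<noteq> z" "y \<noteq> z"
  shows "incidence [y, z] [x, y, z] = 1"
    and "incidence [x, z] [x, y, z] = - 1"
    and "incidence [x, y] [x, y, z] = 1"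
  using assms by (auto simp: incidence_def delete_nth_def lessThan_Suc eval_nat_numeral)

lemma one_face_cases:
  assumes "F \<in> faces m 1"
  obtains (vertical) a b d where "F = [(a, b), (a, d)]" "b < d"
    | (horizontal) a b c where "F = [(a, b), (c, b)]" "a < c"
    | (diagonal) a b c d where "F = [(a, b), (c, d)]" "a < c" "b < d"
proof -
  from assms have "length F = Suc (Suc 0)" and F: "is_face m F"
    by (auto simp: faces_def)
  then obtain a b c d where "F = [(a, b), (c, d)]"
    by (metis length_0_conv length_Suc_conv surj_pair)
  with F show thesis
    using that by (cases "a = c"; cases "b = d") (auto simp: is_face_pair)
qed

lemma finite_faces: "finite (faces m p)"
proof -
  have "faces m p \<subseteq> {F. set F \<subseteq> {1..m} \<times> {1..m} \<and> length F = p + 1}"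
    by (auto simp: faces_def is_face_def)
  then show ?thesis
    by (rule finite_subset)
      (intro finite_lists_length_eq finite_cartesian_product finite_atLeastAtMost)
qed


section \<open>The matching on edges\<close>

text \<open>
  On an edge only the first six rules of \<open>pairing\<close> can apply. Writing their patterns as equations between
  the entries makes the comparison of two rules a propositional matter.
\<close>

lemma pairing_edge_iff:
  "pairing m [(a, b), (c, d)] B \<longleftrightarrow>
     (a = c \<and> a < m \<and> d < m \<and> B = [(a, b), (c, d), (m, d)]) \<or>
     (a = c \<and> d = m \<and> a < m - 1 \<and> B = [(a, b), (c, d), (m - 1, m)]) \<or>
     (b = d \<and> b < m \<and> c < m \<and> B = [(a, b), (c, d), (c, m)]) \<or>
     (b = d \<and> c = m \<and> b < m - 1 \<and> B = [(a, b), (c, d), (m, m - 1)]) \<or>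
     (a < c \<and> b < d \<and> b \<noteq> c \<and> (c < m \<and> d < m \<or> c = m \<and> d + 1 < m) \<and>
       B = [(a, b), (c, b), (c, d)]) \<or>
     (a < c \<and> b < d \<and> a \<noteq> d \<and> (b = c \<and> c < m \<and> d < m \<or> c + 1 < m \<and> d = m) \<and>
       B = [(a, b), (a, d), (c, d)])"
  (is "?L \<longleftrightarrow> ?R")
proof
  show "?L \<Longrightarrow> ?R" by (cases rule: pairing.cases, assumption) (simp_all, metis)
  assume ?R
  then show ?L
    by - (elim disjE conjE; hypsubst; rule pairing.intros; simp)
qed

text \<open>
  Nondegeneracy of the edge is essential: on a repeated column the first and the third rule
  would both apply.
\<close>

lemma gradient_functional:
  assumes "gradient m F B" "gradient m F B'" "length F = 2"
  shows "B' = B"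
proof -
  obtain a b c d where F: "F = [(a, b), (c, d)]"
    using assms(3) by (auto simp: numeral_2_eq_2 length_Suc_conv)
  have pair: "pairing m F B" "pairing m F B'" and face: "is_face m F"
    using assms by (auto simp: gradient_def)
  from face have "\<not> (a = c \<and> b = d)"
    by (simp add: F is_face_pair)
  with pair show ?thesis
    unfolding F pairing_edge_iff by - (elim disjE conjE; simp)
qed

lemma gradient_injective:
  assumes "gradient m F B" "gradient m F' B" "length F = 2"
  shows "F' = F"
proof -
  obtain a b c d where F: "F = [(a, b), (c, d)]"
    using assms(3) by (auto simp: numeral_2_eq_2 length_Suc_conv)
  have pair: "pairing m F B" "pairing m F' B" and "is_face m F" "is_face m F'" "is_face m B"
    using assms by (auto simp: gradient_def)
  from pair(1) have "length B = 3"
    unfolding F pairing_edge_iff by auto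
  with pair(2) have "length F' = 2"
    by cases auto
  then obtain a' b' c' d' where F': "F' = [(a', b'), (c', d')]"
    by (auto simp: numeral_2_eq_2 length_Suc_conv)
  have "\<not> (a = c \<and> b = d)" "\<not> (a' = c' \<and> b' = d')"
    using \<open>is_face m F\<close> \<open>is_face m F'\<close> by (auto simp: is_face_pair F F')
  with pair show ?thesis
    unfolding F F' pairing_edge_iff by - (elim disjE conjE; simp)
qed


section \<open>Total multiplicity of upper paths\<close>

text \<open>
  Finiteness is part of the notion since the sum over an infinite set of paths would be 0 by default.
\<close>

definition has_weight :: "nat \<Rightarrow> face \<Rightarrow> face \<Rightarrow> int \<Rightarrow> bool" where
  "has_weight m \<alpha> F s \<longleftrightarrow>
     finite (upper_paths m F \<alpha>) \<and> (\<Sum>l\<in>upper_paths m F \<alpha>. multiplicity F l) = s"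

lemma has_weight_unpaired:
  assumes "\<And>B. \<not> gradient m F B"
  shows "has_weight m \<alpha> F (of_bool (F = \<alpha>))"
proof -
  have "is_upper_path m F l \<alpha> \<longleftrightarrow> l = [] \<and> F = \<alpha>" for l
    using assms by (cases "(m, F, l, \<alpha>)" rule: is_upper_path.cases) auto
  then have "upper_paths m F \<alpha> = (if F = \<alpha> then {[]} else {})"
    by (auto simp: upper_paths_def)
  then show ?thesis
    by (simp add: has_weight_def)
qed

text \<open>
  The path sums obey the recursion along the first step. As \<open>W\<close> is a matching, the step goes up to
  \<open>B\<close>, and then down to either of the facets of \<open>B\<close> other than \<open>F\<close>; the two families of paths are disjoint.
\<close>

lemma has_weight_step:
  assumes grad: "gradient m F B" and len: "length F = 2" and "F \<noteq> \<alpha>"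
    and facets: "{A. is_facet m A B} = {F, G, H}" and distinct: "F \<noteq> G" "F \<noteq> H" "G \<noteq> H"
    and G: "has_weight m \<alpha> G s" and H: "has_weight m \<alpha> H t"
  shows "has_weight m \<alpha> F (- incidence F B * (incidence G B * s + incidence H B * t))"
proof -
  have "gradient m F B' \<longleftrightarrow> B' = B" for B'
    using gradient_functional[OF grad _ len] grad by blast
  moreover have "is_facet m A B \<and> \<not> gradient m A B \<longleftrightarrow> A = G \<or> A = H" for A
  proof -
    have "gradient m A B \<longleftrightarrow> A = F"
      using gradient_injective[OF grad _ len] grad by blast
    then show ?thesis
      using facets distinct by auto
  qed
  ultimately have path: "is_upper_path m F l \<alpha> \<longleftrightarrow>
      (\<exists>A l'. l = (B, A) # l' \<and> (A = G \<or> A = H) \<and> is_upper_path m A l' \<alpha>)" for l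
    using \<open>F \<noteq> \<alpha>\<close> by (cases "(m, F, l, \<alpha>)" rule: is_upper_path.cases) auto
  let ?paths = "\<lambda>A. Cons (B, A) ` upper_paths m A \<alpha>"
  have paths: "upper_paths m F \<alpha> = ?paths G \<union> ?paths H"
    using path by (auto simp: upper_paths_def image_iff)
  (* Each path in one family has the sign of its first step as a common factor. *)
  have sum_paths: "sum (multiplicity F) (?paths A) = - (incidence F B * incidence A B) * r"
    if "has_weight m \<alpha> A r" for A r
    using that by (simp add: sum.reindex has_weight_def sum_negf flip: sum_distrib_left)
  have "finite (?paths G)" "finite (?paths H)"
    using G H by (auto simp: has_weight_def)
  moreover have "?paths G \<inter> ?paths H = {}"
    using distinct by auto
  ultimately have fin: "finite (upper_paths m F \<alpha>)"
    and sum: "sum (multiplicity F) (upper_paths m F \<alpha>)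
      = sum (multiplicity F) (?paths G) + sum (multiplicity F) (?paths H)"
    unfolding paths by (blast, rule sum.union_disjoint)
  have "- (p * q) * s + - (p * r) * t = - p * (q * s + r * t)" for p q r :: int
    by (simp add: algebra_simps)
  with fin sum show ?thesis
    unfolding has_weight_def sum_paths[OF G] sum_paths[OF H] by metis
qed

lemma has_weight_drop_last:
  assumes grad: "gradient m [x, y] [x, y, z]" and "[x, y] \<noteq> \<alpha>"
    and "has_weight m \<alpha> [x, z] s" "has_weight m \<alpha> [y, z] t"
  shows "has_weight m \<alpha> [x, y] (s - t)"
proof -
  from grad have face: "is_face m [x, y, z]"
    by (simp add: gradient_def)
  note neq = columns_of_triple_distinct[OF face]
  have "has_weight m \<alpha> [x, y] (- incidence [x, y] [x, y, z] *
      (incidence [x, z] [x, y, z] * s + incidence [y, z] [x, y, z] * t))"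
    by (rule has_weight_step[OF grad _ assms(2) facets_of_triple[OF face] _ _ _ assms(3,4)])
      (simp_all add: neq neq[symmetric])
  moreover have "- 1 * (- 1 * s + 1 * t) = s - t"
    by simp
  ultimately show ?thesis
    unfolding incidence_triple[OF neq] by (simp only:)
qed

lemma has_weight_drop_middle:
  assumes grad: "gradient m [x, z] [x, y, z]" and "[x, z] \<noteq> \<alpha>"
    and "has_weight m \<alpha> [x, y] s" "has_weight m \<alpha> [y, z] t"
  shows "has_weight m \<alpha> [x, z] (s + t)"
proof -
  from grad have face: "is_face m [x, y, z]"
    by (simp add: gradient_def)
  note neq = columns_of_triple_distinct[OF face]
  have facets: "{A. is_facet m A [x, y, z]} = {[x, z], [x, y], [y, z]}"
    using facets_of_triple[OF face] by auto
  have "has_weight m \<alpha> [x, z] (- incidence [x, z] [x, y, z] *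
      (incidence [x, y] [x, y, z] * s + incidence [y, z] [x, y, z] * t))"
    by (rule has_weight_step[OF grad _ assms(2) facets _ _ _ assms(3,4)])
      (simp_all add: neq neq[symmetric])
  then show ?thesis
    unfolding incidence_triple[OF neq] by (simp only: mult_1 minus_minus)
qed


section \<open>Weights of the edges for a critical edge\<close>

text \<open>
  Weights are evaluated for the three types of critical edges at once: what enters is that \<open>\<alpha>\<close> is
  unpaired and differs from certain edges near the largest indices.
\<close>

definition critical_shape :: "nat \<Rightarrow> face \<Rightarrow> bool" where
  "critical_shape m \<alpha> \<longleftrightarrow> is_face m \<alpha> \<and>
     ((\<exists>a b. \<alpha> = [(a, b), (m - 1, m)] \<and> (a = m - 1 \<and> m - 1 > b + 1 \<or> a < m - 1 \<and> m - 1 \<ge> b)) \<or>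
      (\<exists>b d. \<alpha> = [(m, b), (m, d)] \<and> d < m - 1) \<or>
      (\<exists>a c. \<alpha> = [(a, m), (c, m)] \<and> c < m - 1))"

lemma critical_shape_unpaired:
  assumes "critical_shape m \<alpha>"
  shows "\<not> gradient m \<alpha> B" "\<not> gradient m A \<alpha>"
proof -
  show "\<not> gradient m \<alpha> B"
  proof
    assume "gradient m \<alpha> B"
    then have "pairing m \<alpha> B" by (simp add: gradient_def)
    then show False
      using assms by cases (auto simp: critical_shape_def is_face_pair)
  qed
  show "\<not> gradient m A \<alpha>"
  proof
    assume "gradient m A \<alpha>"
    then have "pairing m A \<alpha>" by (simp add: gradient_def)
    then show False
      using assms by cases (auto simp: critical_shape_def is_face_pair)
  qed
qed

lemma critical_shape_critical:
  assumes "critical_shape m \<alpha>"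
  shows "\<alpha> \<in> critical_faces m 1"
  using assms critical_shape_unpaired[OF assms]
  by (auto simp: critical_faces_def faces_def critical_shape_def)

lemma gradient_ne_critical:
  assumes "critical_shape m \<alpha>" "gradient m F B"
  shows "F \<noteq> \<alpha>"
  using assms critical_shape_unpaired by blast

text \<open>
  Here the recursions end: the side conditions of the pairing rules exclude these positions of the
  largest indices.
\<close>

lemma weight_unpaired_edge:
  assumes "is_face m [(a, b), (c, d)]"
    and "a = m \<or> (a = m - 1 \<and> d = m) \<or> b = m \<or> (c = m \<and> d = m - 1) \<or> (c = m - 1 \<and> d = m)"
  shows "has_weight m \<alpha> [(a, b), (c, d)] (of_bool ([(a, b), (c, d)] = \<alpha>))"
proof (rule has_weight_unpaired, rule notI)
  fix B assume "gradient m [(a, b), (c, d)] B"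
  then have "pairing m [(a, b), (c, d)] B" by (simp add: gradient_def)
  then show False
    using assms by cases (auto simp: is_face_pair)
qed

text \<open>
  For \<open>b < m - 1\<close> the pairing leads to two edges that end in \<open>(m, m - 1)\<close>. These are not paired upwards and
  they are not critical, so no path continues from them to \<open>\<alpha>\<close>. For \<open>b = m - 1\<close> the edge is itself such an
  edge.
\<close>

lemma weight_horizontal_last:
  assumes \<alpha>: "critical_shape m \<alpha>" and face: "is_face m [(a, b), (m, b)]"
  shows "has_weight m \<alpha> [(a, b), (m, b)] 0"
proof (cases "b < m - 1")
  case True
  have grad: "gradient m [(a, b), (m, b)] [(a, b), (m, b), (m, m - 1)]"
    using face True by (auto simp: gradient_def is_face_pair is_face_triple
        intro: pairing.intros[unfolded One_nat_def])
  have "is_face m [(a, b), (m, m - 1)]" "is_face m [(m, b), (m, m - 1)]"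
    using face True by (auto simp: is_face_pair)
  moreover have "[(a, b), (m, m - 1)] \<noteq> \<alpha>" "[(m, b), (m, m - 1)] \<noteq> \<alpha>"
    using \<alpha> True by (auto simp: critical_shape_def)
  ultimately have "has_weight m \<alpha> [(a, b), (m, m - 1)] 0"
    "has_weight m \<alpha> [(m, b), (m, m - 1)] 0"
    using weight_unpaired_edge[of m a b m "m - 1" \<alpha>] weight_unpaired_edge[of m m b m "m - 1" \<alpha>]
    by auto
  from has_weight_drop_last[OF grad gradient_ne_critical[OF \<alpha> grad] this]
  show ?thesis by simp
next
  case False
  then have "b = m - 1"
    using face by (auto simp: is_face_pair)
  moreover have "[(a, b), (m, b)] \<noteq> \<alpha>"
    using \<alpha> face \<open>b = m - 1\<close> by (auto simp: critical_shape_def is_face_pair)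
  ultimately show ?thesis
    using weight_unpaired_edge[of m a b m b \<alpha>] face by auto
qed

text \<open>
  The inserted column is \<open>(m, b)\<close>; the side \<open>[(a, b), (m, b)]\<close> contributes nothing by the previous lemma.
  For \<open>d = m - 1\<close> the edge is unpaired upwards, and both sides of the claim vanish since no critical edge ends in
  \<open>(m, m - 1)\<close>.
\<close>

lemma weight_diagonal_right:
  assumes \<alpha>: "critical_shape m \<alpha>" and face: "is_face m [(a, b), (m, d)]"
    and "a < m" "b < d" "d < m"
  shows "has_weight m \<alpha> [(a, b), (m, d)] (of_bool (\<alpha> = [(m, b), (m, d)]))"
proof (cases "d < m - 1")
  case True
  have grad: "gradient m [(a, b), (m, d)] [(a, b), (m, b), (m, d)]"
    using face assms True
    by (auto simp: gradient_def is_face_pair is_face_triple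
        intro: pairing.intros[unfolded One_nat_def])
  have "has_weight m \<alpha> [(a, b), (m, b)] 0"
    using assms by (intro weight_horizontal_last) (auto simp: is_face_pair)
  moreover have "has_weight m \<alpha> [(m, b), (m, d)] (of_bool ([(m, b), (m, d)] = \<alpha>))"
    using assms by (intro weight_unpaired_edge) (auto simp: is_face_pair)
  ultimately have "has_weight m \<alpha> [(a, b), (m, d)] (0 + of_bool ([(m, b), (m, d)] = \<alpha>))"
    by (rule has_weight_drop_middle[OF grad gradient_ne_critical[OF \<alpha> grad]])
  then show ?thesis
    by (simp add: eq_commute)
next
  case False
  with assms have "d = m - 1" by auto
  moreover have "\<alpha> \<noteq> [(m, b), (m, d)]" "\<alpha> \<noteq> [(a, b), (m, d)]"
    using \<alpha> assms \<open>d = m - 1\<close> by (auto simp: critical_shape_def)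
  ultimately show ?thesis
    using weight_unpaired_edge[of m a b m d \<alpha>] face by auto
qed

text \<open>
  Such an edge is shifted to the upper entry \<open>m\<close>, whatever its own upper entry is; hence all these edges with
  the same lower row have the same weight.
\<close>

lemma weight_vertical:
  assumes \<alpha>: "critical_shape m \<alpha>" and face: "is_face m [(a, b), (a, d)]" and "d < m"
  shows "has_weight m \<alpha> [(a, b), (a, d)] (of_bool (\<alpha> = [(m, b), (m, d)]))"
proof (cases "a = m")
  case True
  then show ?thesis
    using weight_unpaired_edge[of m a b a d \<alpha>] face by (auto simp: eq_commute)
next
  case False
  have grad: "gradient m [(a, b), (a, d)] [(a, b), (a, d), (m, d)]"
    using assms False
    by (auto simp: gradient_def is_face_pair is_face_triple
        intro: pairing.intros[unfolded One_nat_def])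
  have "has_weight m \<alpha> [(a, b), (m, d)] (of_bool (\<alpha> = [(m, b), (m, d)]))"
    using assms False by (intro weight_diagonal_right) (auto simp: is_face_pair)
  moreover have "has_weight m \<alpha> [(a, d), (m, d)] 0"
    using assms False by (intro weight_horizontal_last) (auto simp: is_face_pair)
  ultimately have "has_weight m \<alpha> [(a, b), (a, d)] (of_bool (\<alpha> = [(m, b), (m, d)]) - 0)"
    by (rule has_weight_drop_last[OF grad gradient_ne_critical[OF \<alpha> grad]])
  then show ?thesis
    by simp
qed

text \<open>
  The target \<open>(m - 1, m)\<close> replaces \<open>(m, m)\<close>, which is not a column. For \<open>a = m - 1\<close> the edge in the
  indicator is the edge \<open>[(a, b), (a, m)]\<close> itself.
\<close>

lemma weight_vertical_top:
  assumes \<alpha>: "critical_shape m \<alpha>" and face: "is_face m [(a, b), (a, m)]"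
  shows "has_weight m \<alpha> [(a, b), (a, m)] (of_bool (\<alpha> = [(a, b), (m - 1, m)]))"
proof (cases "a = m - 1")
  case True
  then show ?thesis
    using weight_unpaired_edge[of m a b a m \<alpha>] face by (auto simp: eq_commute)
next
  case False
  then have "a < m - 1"
    using face by (auto simp: is_face_pair)
  then have grad: "gradient m [(a, b), (a, m)] [(a, b), (a, m), (m - 1, m)]"
    using face by (auto simp: gradient_def is_face_pair is_face_triple
        intro: pairing.intros[unfolded One_nat_def])
  have "has_weight m \<alpha> [(a, b), (m - 1, m)] (of_bool ([(a, b), (m - 1, m)] = \<alpha>))"
    "has_weight m \<alpha> [(a, m), (m - 1, m)] (of_bool ([(a, m), (m - 1, m)] = \<alpha>))"
    using face \<open>a < m - 1\<close> by (intro weight_unpaired_edge; auto simp: is_face_pair)+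
  then have "has_weight m \<alpha> [(a, b), (a, m)]
      (of_bool ([(a, b), (m - 1, m)] = \<alpha>) - of_bool ([(a, m), (m - 1, m)] = \<alpha>))"
    by (rule has_weight_drop_last[OF grad gradient_ne_critical[OF \<alpha> grad]])
  moreover have "[(a, m), (m - 1, m)] \<noteq> \<alpha>"
    using \<alpha> \<open>a < m - 1\<close> by (auto simp: critical_shape_def)
  ultimately show ?thesis
    by (simp add: eq_commute)
qed

lemma weight_diagonal_top:
  assumes \<alpha>: "critical_shape m \<alpha>" and face: "is_face m [(a, b), (c, m)]" and "a < c" "b < m"
  shows "has_weight m \<alpha> [(a, b), (c, m)]
    (of_bool (\<alpha> = [(a, m), (c, m)]) + of_bool (\<alpha> = [(a, b), (m - 1, m)]))"
proof (cases "c = m - 1")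
  case True
  have "\<alpha> \<noteq> [(a, m), (m - 1, m)]"
    using \<alpha> assms True by (auto simp: critical_shape_def)
  then show ?thesis
    using weight_unpaired_edge[of m a b c m \<alpha>] face True by (auto simp: eq_commute)
next
  case False
  then have "c < m - 1"
    using face by (auto simp: is_face_pair)
  then have grad: "gradient m [(a, b), (c, m)] [(a, b), (a, m), (c, m)]"
    using assms by (auto simp: gradient_def is_face_pair is_face_triple
        intro: pairing.intros[unfolded One_nat_def])
  have "has_weight m \<alpha> [(a, b), (a, m)] (of_bool (\<alpha> = [(a, b), (m - 1, m)]))"
    using assms by (intro weight_vertical_top) (auto simp: is_face_pair)
  moreover have "has_weight m \<alpha> [(a, m), (c, m)] (of_bool ([(a, m), (c, m)] = \<alpha>))"
    using assms by (intro weight_unpaired_edge) (auto simp: is_face_pair)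
  ultimately have "has_weight m \<alpha> [(a, b), (c, m)]
    (of_bool (\<alpha> = [(a, b), (m - 1, m)]) + of_bool ([(a, m), (c, m)] = \<alpha>))"
    by (rule has_weight_drop_middle[OF grad gradient_ne_critical[OF \<alpha> grad]])
  then show ?thesis
    by (simp add: add.commute eq_commute)
qed

text \<open>
  The pairing inserts \<open>(c, m)\<close> at the end, so the weight is that of the diagonal edge from \<open>(a, b)\<close> to \<open>(c, m)\<close>
  minus that of the edge from \<open>(c, b)\<close> to \<open>(c, m)\<close>. The first contributes the two positive indicators.
\<close>

lemma weight_horizontal:
  assumes \<alpha>: "critical_shape m \<alpha>" and face: "is_face m [(a, b), (c, b)]"
    and "a < c" "c < m" "b < m"
  shows "has_weight m \<alpha> [(a, b), (c, b)]
    (of_bool (\<alpha> = [(a, m), (c, m)]) + of_bool (\<alpha> = [(a, b), (m - 1, m)])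
      - of_bool (\<alpha> = [(c, b), (m - 1, m)]))"
proof -
  have grad: "gradient m [(a, b), (c, b)] [(a, b), (c, b), (c, m)]"
    using assms by (auto simp: gradient_def is_face_pair is_face_triple
        intro: pairing.intros[unfolded One_nat_def])
  show ?thesis
    using assms
    by (intro has_weight_drop_last[OF grad gradient_ne_critical[OF \<alpha> grad]]
        weight_diagonal_top weight_vertical_top)
      (auto simp: is_face_pair)
qed

lemma weight_horizontal_top:
  assumes "is_face m [(a, m), (c, m)]"
  shows "has_weight m \<alpha> [(a, m), (c, m)] (of_bool (\<alpha> = [(a, m), (c, m)]))"
  using weight_unpaired_edge[of m a m c m \<alpha>] assms by (auto simp: eq_commute)


section \<open>Cochains modulo the diagonal edges\<close>

lemma sum_apply: "(\<Sum>x\<in>S. f x) F = (\<Sum>x\<in>S. f x F)"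
  by (induction S rule: infinite_finite_induct) auto

lemma sum_dual_apply:
  assumes "inj_on g S" "finite S"
  shows "(\<Sum>x\<in>S. dual (g x) :: 'r::comm_ring_1 cochain) F = of_bool (F \<in> g ` S)"
proof -
  have "(\<Sum>x\<in>S. dual (g x) :: 'r cochain) F = (\<Sum>G\<in>g ` S. if F = G then 1 else 0)"
    using assms(1) by (simp add: sum_apply dual_def sum.reindex)
  then show ?thesis
    using assms(2) by simp
qed

lemma Phi_dual:
  assumes "\<alpha> \<in> critical_faces m p"
  shows "Phi m p (dual \<alpha> :: 'r::comm_ring_1 cochain) = Phi_basis m p \<alpha>"
proof -
  have "finite (critical_faces m p)"
    by (rule finite_subset[OF _ finite_faces[of m p]]) (auto simp: critical_faces_def)
  then show ?thesis
    using assms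
    by (simp add: Phi_def dual_def if_distrib[of "\<lambda>r. r *\<^sub>C _"] cong: if_cong)
qed

lemma Phi_basis_apply:
  "(Phi_basis m p \<alpha> :: 'r::comm_ring_1 cochain) F =
     (if F \<in> faces m p then of_int (\<Sum>l\<in>upper_paths m F \<alpha>. multiplicity F l) else 0)"
  by (simp add: Phi_basis_def sum_apply cochain_scale_def dual_def finite_faces
      if_distrib[of "\<lambda>r. _ * r"] cong: if_cong)

text \<open>
  The span of duals of diagonal edges consists of the cochains supported on these edges, since
  there are only finitely many of them.
\<close>

lemma diagonal_congI:
  fixes f g :: "'r::comm_ring_1 cochain"
  assumes "\<And>F. F \<notin> faces m 1 \<Longrightarrow> f F = g F"
    and "\<And>a b d. [(a, b), (a, d)] \<in> faces m 1 \<Longrightarrow> b < d \<Longrightarrow>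
      f [(a, b), (a, d)] = g [(a, b), (a, d)]"
    and "\<And>a b c. [(a, b), (c, b)] \<in> faces m 1 \<Longrightarrow> a < c \<Longrightarrow>
      f [(a, b), (c, b)] = g [(a, b), (c, b)]"
  shows "diagonal_cong m f g"
proof -
  let ?D = "{[(a, b), (c, d)] | a b c d. [(a, b), (c, d)] \<in> faces m 1 \<and> a < c \<and> b < d}"
  have fin: "finite ?D"
    by (rule finite_subset[OF _ finite_faces[of m 1]]) auto
  have "f F - g F = 0" if "F \<notin> ?D" for F
  proof (cases "F \<in> faces m 1")
    case True
    then show ?thesis
      by (cases rule: one_face_cases) (use True assms that in auto)
  qed (use assms(1) in auto)
  then have "f - g = (\<Sum>F\<in>?D. (f - g) F *\<^sub>C dual F)"
    using fin
    by (auto simp: fun_eq_iff sum_apply cochain_scale_def dual_def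
        if_distrib[of "\<lambda>r. _ * r"] simp del: mem_Collect_eq cong: if_cong)
  also have "\<dots> \<in> cochain.span (dual ` ?D)"
    by (intro cochain.span_sum cochain.span_scale cochain.span_base imageI)
  also have "dual ` ?D = {dual [(a, b), (c, d)] | a b c d.
      [(a, b), (c, d)] \<in> faces m 1 \<and> a < c \<and> b < d}"
    by blast
  finally show ?thesis
    unfolding diagonal_cong_def diagonal_span_def .
qed

text \<open>
  Reduces the congruence to a comparison of \<open>g\<close> with the weights on the five kinds of edges with a constant
  row.
\<close>

lemma Phi_critical_congI:
  fixes g :: "'r::comm_ring_1 cochain"
  assumes \<alpha>: "critical_shape m \<alpha>"
    and outside: "\<And>F. F \<notin> faces m 1 \<Longrightarrow> g F = 0"
    and vertical: "\<And>a b d. is_face m [(a, b), (a, d)] \<Longrightarrow> b < d \<Longrightarrow> d < m \<Longrightarrow>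
      g [(a, b), (a, d)] = of_bool (\<alpha> = [(m, b), (m, d)])"
    and vertical_top: "\<And>a b. is_face m [(a, b), (a, m)] \<Longrightarrow> b < m \<Longrightarrow>
      g [(a, b), (a, m)] = of_bool (\<alpha> = [(a, b), (m - 1, m)])"
    and horizontal: "\<And>a b c. is_face m [(a, b), (c, b)] \<Longrightarrow> a < c \<Longrightarrow> c < m \<Longrightarrow> b < m \<Longrightarrow>
      g [(a, b), (c, b)] = of_bool (\<alpha> = [(a, m), (c, m)])
        + of_bool (\<alpha> = [(a, b), (m - 1, m)]) - of_bool (\<alpha> = [(c, b), (m - 1, m)])"
    and horizontal_last: "\<And>a b. is_face m [(a, b), (m, b)] \<Longrightarrow> a < m \<Longrightarrow>
      g [(a, b), (m, b)] = 0"
    and horizontal_top: "\<And>a c. is_face m [(a, m), (c, m)] \<Longrightarrow> a < c \<Longrightarrow> c < m \<Longrightarrow>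
      g [(a, m), (c, m)] = of_bool (\<alpha> = [(a, m), (c, m)])"
  shows "diagonal_cong m (Phi m 1 (dual \<alpha>)) g"
proof -
  have coeff: "(Phi m 1 (dual \<alpha>) :: 'r cochain) F = of_int s"
    if "has_weight m \<alpha> F s" "F \<in> faces m 1" for F s
    using that critical_shape_critical[OF \<alpha>]
    by (simp add: Phi_dual Phi_basis_apply has_weight_def)
  show ?thesis
  proof (rule diagonal_congI)
    show "(Phi m 1 (dual \<alpha>) :: 'r cochain) F = g F" if "F \<notin> faces m 1" for F
      using that outside critical_shape_critical[OF \<alpha>] by (simp add: Phi_dual Phi_basis_apply)
  next
    fix a b d assume F: "[(a, b), (a, d)] \<in> faces m 1" and "b < d"
    then have face: "is_face m [(a, b), (a, d)]"
      by (simp add: faces_def)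
    then consider "d < m" | "d = m"
      by (force simp: is_face_pair)
    then show "(Phi m 1 (dual \<alpha>) :: 'r cochain) [(a, b), (a, d)] = g [(a, b), (a, d)]"
    proof cases
      case 1
      then show ?thesis
        using coeff[OF weight_vertical[OF \<alpha> face] F] vertical[OF face \<open>b < d\<close>] by simp
    next
      case 2
      then show ?thesis
        using coeff[OF weight_vertical_top[OF \<alpha>]] vertical_top face F \<open>b < d\<close> by simp
    qed
  next
    fix a b c assume F: "[(a, b), (c, b)] \<in> faces m 1" and "a < c"
    then have face: "is_face m [(a, b), (c, b)]"
      by (simp add: faces_def)
    then consider "c = m" | "c < m" "b < m" | "c < m" "b = m"
      by (force simp: is_face_pair)
    then show "(Phi m 1 (dual \<alpha>) :: 'r cochain) [(a, b), (c, b)] = g [(a, b), (c, b)]"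
    proof cases
      case 1
      then show ?thesis
        using coeff[OF weight_horizontal_last[OF \<alpha>]] horizontal_last face F \<open>a < c\<close> by simp
    next
      case 2
      then show ?thesis
        using coeff[OF weight_horizontal[OF \<alpha> face \<open>a < c\<close>] F] horizontal[OF face \<open>a < c\<close>] by simp
    next
      case 3
      then show ?thesis
        using coeff[OF weight_horizontal_top] horizontal_top face F \<open>a < c\<close> by simp
    qed
  qed
qed

theorem proposition4p12:
  fixes m :: nat
  assumes "m \<ge> 5"
  shows
    "(\<forall>a b. [(a, b), (m - 1, m)] \<in> faces m 1 \<and>
        ((a = m - 1 \<and> m - 1 > b + 1) \<or> (a < m - 1 \<and> m - 1 \<ge> b)) \<longrightarrow>
        diagonal_cong m
          (Phi m 1 (dual [(a, b), (m - 1, m)] :: 'r::comm_ring_1 cochain))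
          (dual [(a, b), (a, m)]
            + (\<Sum>x\<in>{x\<in>{1..m - 1}. a < x \<and> x \<noteq> b}. dual [(a, b), (x, b)])
            - (\<Sum>y\<in>{y\<in>{1..m - 1}. b \<noteq> y \<and> y < a}. dual [(y, b), (a, b)])))
     \<and> (\<forall>b d. [(m, b), (m, d)] \<in> faces m 1 \<and> d < m - 1 \<longrightarrow>
        diagonal_cong m
          (Phi m 1 (dual [(m, b), (m, d)] :: 'r cochain))
          (\<Sum>x\<in>{x\<in>{1..m}. b \<noteq> x \<and> x \<noteq> d}. dual [(x, b), (x, d)]))
     \<and> (\<forall>a c. [(a, m), (c, m)] \<in> faces m 1 \<and> c < m - 1 \<longrightarrow>
        diagonal_cong m
          (Phi m 1 (dual [(a, m), (c, m)] :: 'r cochain))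
          (\<Sum>y\<in>{y\<in>{1..m}. a \<noteq> y \<and> y \<noteq> c}. dual [(a, y), (c, y)]))"
proof (intro conjI allI impI)
  fix a b
  assume *: "[(a, b), (m - 1, m)] \<in> faces m 1 \<and>
    (a = m - 1 \<and> m - 1 > b + 1 \<or> a < m - 1 \<and> m - 1 \<ge> b)"
  then have ab: "a \<in> {1..m - 1}" "b \<in> {1..m - 1}" "a \<noteq> b"
    using assms by (auto simp: faces_def is_face_pair)
  have shape: "critical_shape m [(a, b), (m - 1, m)]"
    using * by (auto simp: critical_shape_def faces_def)
  define g :: "'r cochain" where "g = dual [(a, b), (a, m)]
      + (\<Sum>x\<in>{x\<in>{1..m - 1}. a < x \<and> x \<noteq> b}. dual [(a, b), (x, b)])
      - (\<Sum>y\<in>{y\<in>{1..m - 1}. b \<noteq> y \<and> y < a}. dual [(y, b), (a, b)])"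
  have g_apply: "g F = of_bool (F = [(a, b), (a, m)])
      + of_bool (F \<in> (\<lambda>x. [(a, b), (x, b)]) ` {x\<in>{1..m - 1}. a < x \<and> x \<noteq> b})
      - of_bool (F \<in> (\<lambda>y. [(y, b), (a, b)]) ` {y\<in>{1..m - 1}. b \<noteq> y \<and> y < a})" for F
  proof -
    have "inj_on (\<lambda>x. [(a, b), (x, b)]) S" "inj_on (\<lambda>y. [(y, b), (a, b)]) S" for S
      by (auto simp: inj_on_def)
    then show ?thesis
      by (simp add: g_def sum_dual_apply dual_def[of "[(a, b), (a, m)]"])
  qed
  have "diagonal_cong m (Phi m 1 (dual [(a, b), (m - 1, m)])) g"
    by (rule Phi_critical_congI[OF shape])
      (use ab assms in \<open>auto simp: g_apply is_face_pair faces_def image_iff\<close>)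
  then show "diagonal_cong m
      (Phi m 1 (dual [(a, b), (m - 1, m)] :: 'r cochain))
      (dual [(a, b), (a, m)]
        + (\<Sum>x\<in>{x\<in>{1..m - 1}. a < x \<and> x \<noteq> b}. dual [(a, b), (x, b)])
        - (\<Sum>y\<in>{y\<in>{1..m - 1}. b \<noteq> y \<and> y < a}. dual [(y, b), (a, b)]))"
    unfolding g_def .
next
  fix b d
  assume *: "[(m, b), (m, d)] \<in> faces m 1 \<and> d < m - 1"
  then have bd: "1 \<le> b" "b < d"
    by (auto simp: faces_def is_face_pair)
  have shape: "critical_shape m [(m, b), (m, d)]"
    using * by (auto simp: critical_shape_def faces_def)
  show "diagonal_cong m
      (Phi m 1 (dual [(m, b), (m, d)] :: 'r cochain))
      (\<Sum>x\<in>{x\<in>{1..m}. b \<noteq> x \<and> x \<noteq> d}. dual [(x, b), (x, d)])"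
    by (rule Phi_critical_congI[OF shape])
      (use bd * assms in \<open>auto simp: sum_dual_apply inj_on_def is_face_pair faces_def image_iff\<close>)
next
  fix a c
  assume *: "[(a, m), (c, m)] \<in> faces m 1 \<and> c < m - 1"
  then have ac: "1 \<le> a" "a < c"
    by (auto simp: faces_def is_face_pair)
  have shape: "critical_shape m [(a, m), (c, m)]"
    using * by (auto simp: critical_shape_def faces_def)
  show "diagonal_cong m
      (Phi m 1 (dual [(a, m), (c, m)] :: 'r cochain))
      (\<Sum>y\<in>{y\<in>{1..m}. a \<noteq> y \<and> y \<noteq> c}. dual [(a, y), (c, y)])"
    by (rule Phi_critical_congI[OF shape])
      (use ac * assms in \<open>auto simp: sum_dual_apply inj_on_def is_face_pair faces_def image_iff\<close>)
qed

end
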